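(* Let $S$ be a complete folding sequence. Then for each integer $t\ge 7$, $S$ has exactly $4t$ distinct subwords of length $t$; and for $t=1,2,3,4,5,6$ the number of distinct subwords of length $t$ of $S$ is respectively $2,4,8,12,18,23$.
   Context: All sequences take values in $\{+1,-1\}$. For a finite sequence $S=(a_1,\dots,a_n)$ write $\overline{S}=(-a_n,\dots,-a_1)$. The $n$-folding sequences are defined recursively: the only $0$-folding sequence is the empty sequence, and the $(n+1)$-folding sequences are exactly $(\overline{S},+1,S)$ and $(\overline{S},-1,S)$ with $S$ an $n$-folding sequence. A finite sequence $(u_1,\dots,u_m)$ is a subword of a sequence $(b_k)$ if there is $h$ with $u_k=b_{k+h}$ for $1\le k\le m$. A finite folding sequence is a subword of some $n$-folding sequence. A complete folding sequence is a sequence $(a_k)_{k\in\mathbb{Z}}$ all of whose finite subwords are finite folding sequences. *)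

theory Defs
  imports Main "HOL-Library.Sublist"
begin

definition bar :: "int list \<Rightarrow> int list" where
  "bar S = rev (map uminus S)"

inductive n_folding :: "nat \<Rightarrow> int list \<Rightarrow> bool" where
  zero: "n_folding 0 []"
| plus: "n_folding n S \<Longrightarrow> n_folding (Suc n) (bar S @ [1] @ S)"
| minus: "n_folding n S \<Longrightarrow> n_folding (Suc n) (bar S @ [-1] @ S)"

text \<open>\<^const>\<open>sublist\<close> is the library's relation of being a contiguous block of a list.\<close>

definition finite_folding :: "int list \<Rightarrow> bool" where
  "finite_folding u \<longleftrightarrow> (\<exists>n S. n_folding n S \<and> sublist u S)"

text \<open>Lists are indexed from 0, so the shift \<open>h\<close> below is the usual one
  for indices starting at 1, increased by one.\<close>

definition subword :: "int list \<Rightarrow> (int \<Rightarrow> int) \<Rightarrow> bool" where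
  "subword u b \<longleftrightarrow> (\<exists>h::int. \<forall>k<length u. u ! k = b (int k + h))"

definition complete_folding :: "(int \<Rightarrow> int) \<Rightarrow> bool" where
  "complete_folding a \<longleftrightarrow>
     (\<forall>k. a k \<in> {1, -1}) \<and> (\<forall>u. subword u a \<longrightarrow> finite_folding u)"

definition subwords_of_length :: "nat \<Rightarrow> (int \<Rightarrow> int) \<Rightarrow> int list set" where
  "subwords_of_length t a = {u. length u = t \<and> subword u a}"

end

theory Submission
  imports Defs
begin

text \<open>Every folding sequence interleaves an alternating sequence with another folding sequence.
  Hence, up to a shift, a complete folding sequence \<open>a\<close> has an alternating sequence at its odd
  positions and a complete folding sequence \<open>b\<close> at its even positions. Count the windows of length
  \<open>t\<close> together with the parity of their position: a window of \<open>a\<close> starting at position \<open>h\<close> is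
  determined by one of \<open>b\<close> of about half the length, the parity giving the phase of the alternating
  part. So the number \<open>q(t)\<close> of such pairs satisfies \<open>q(t) = q(\<lfloor>t/2\<rfloor>) + q(\<lceil>t/2\<rceil>)\<close>, and
  \<open>q(t) = 4 t\<close>. A window of length at least 7 determines the parity of its position, because four
  consecutive terms of \<open>b\<close> never alternate in sign. For shorter windows, three unfoldings reduce
  the count to a finite computation.\<close>

section \<open>Interleaving finite folding sequences with alternating signs\<close>

definition alternate :: "int \<Rightarrow> int \<Rightarrow> int" where
  "alternate e k = (if even k then e else - e)"

fun interleave :: "int \<Rightarrow> int list \<Rightarrow> int list" where
  "interleave e [] = [e]"
| "interleave e (x # xs) = e # x # interleave (- e) xs"

lemma length_interleave [simp]: "length (interleave e T) = 2 * length T + 1"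
  by (induction e T rule: interleave.induct) auto

lemma nth_interleave_even:
  "i \<le> length T \<Longrightarrow> interleave e T ! (2 * i) = alternate e (int i)"
proof (induction e T arbitrary: i rule: interleave.induct)
  case (1 e)
  then show ?case by (simp add: alternate_def)
next
  case (2 e x xs)
  then show ?case by (cases i) (auto simp: alternate_def)
qed

lemma nth_interleave_odd:
  "i < length T \<Longrightarrow> interleave e T ! Suc (2 * i) = T ! i"
proof (induction e T arbitrary: i rule: interleave.induct)
  case (2 e x xs)
  then show ?case by (cases i) auto
qed auto

lemma interleave_append:
  "interleave e A @ [c] @ interleave (alternate e (int (length A) + 1)) B = interleave e (A @ [c] @ B)"
  by (induction e A rule: interleave.induct) (auto simp: alternate_def)

lemma interleave_snoc:
  "interleave e (A @ [c]) = interleave e A @ [c, alternate e (int (length A) + 1)]"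
  using interleave_append[of e A c "[]"] by simp

lemma bar_interleave:
  "bar (interleave e T) = interleave (- alternate e (int (length T))) (bar T)"
  by (induction e T rule: interleave.induct)
    (auto simp: bar_def interleave_snoc alternate_def)

text \<open>Folding commutes with interleaving. The reversed half ends in \<open>- e\<close> and the
  other half begins with \<open>e\<close>, so the alternation runs on across \<open>c\<close>, which
  itself falls on an odd index and thus becomes the middle term of the folded inner list.\<close>

lemma interleave_fold:
  "bar (interleave e T) @ [c] @ interleave e T
    = interleave (- alternate e (int (length T))) (bar T @ [c] @ T)"
  using interleave_append[of "- alternate e (int (length T))" "bar T" c T]
  by (simp add: bar_interleave) (auto simp: alternate_def bar_def split: if_splits)

text \<open>The recursion adds the outermost fold, whereas here the innermost one is removed. By
  induction the half \<open>U\<close> is an interleaving, and \<open>interleave_fold\<close> carries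
  the outer fold over to the inner list.\<close>

lemma n_folding_Suc_interleave:
  assumes "n_folding (Suc n) T"
  shows "\<exists>e T'. n_folding n T' \<and> T = interleave e T'"
  using assms
proof (induction n arbitrary: T)
  case 0
  from 0 have "T = interleave 1 [] \<or> T = interleave (- 1) []"
    by (auto elim!: n_folding.cases simp: bar_def)
  then show ?case using n_folding.zero by blast
next
  case (Suc n)
  from Suc.prems obtain U c where U: "n_folding (Suc n) U" "c \<in> {1, - 1}" "T = bar U @ [c] @ U"
    by (cases rule: n_folding.cases) auto
  from Suc.IH[OF U(1)] obtain e V where V: "n_folding n V" "U = interleave e V" by blast
  have "n_folding (Suc n) (bar V @ [c] @ V)"
    using U(2) n_folding.plus[OF V(1)] n_folding.minus[OF V(1)] by auto
  with U(3) V(2) show ?case using interleave_fold by blast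
qed

section \<open>Windows and the unfolding of a complete folding sequence\<close>

definition window :: "(int \<Rightarrow> int) \<Rightarrow> int \<Rightarrow> nat \<Rightarrow> int list" where
  "window a h t = map (\<lambda>i. a (h + int i)) [0..<t]"

lemma length_window [simp]: "length (window a h t) = t"
  by (simp add: window_def)

lemma nth_window [simp]: "i < t \<Longrightarrow> window a h t ! i = a (h + int i)"
  by (simp add: window_def)

lemma window_eq_iff: "window a h t = window b k t \<longleftrightarrow> (\<forall>i<t. a (h + int i) = b (k + int i))"
  by (auto simp: list_eq_iff_nth_eq)

lemma subword_window_iff: "subword u a \<longleftrightarrow> (\<exists>h. u = window a h (length u))"
  by (auto simp: subword_def list_eq_iff_nth_eq add.commute)

lemma subwords_of_length_eq_range: "subwords_of_length t a = range (\<lambda>h. window a h t)"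
  by (auto simp: subwords_of_length_def subword_window_iff)

text \<open>Folding sequences are handled on a window \<open>{-M..M}\<close>: the positions of the parity of \<open>r\<close>
  carry an alternating sequence, and the blocks of the other positions are folding.\<close>

definition unfolds_within :: "(int \<Rightarrow> int) \<Rightarrow> int \<Rightarrow> nat \<Rightarrow> bool" where
  "unfolds_within a r M \<longleftrightarrow>
     (\<forall>k. - int M \<le> 2 * k + r \<and> 2 * k + r + 2 \<le> int M \<longrightarrow> a (2 * k + r + 2) = - a (2 * k + r)) \<and>
     (\<forall>h t. - int M \<le> 2 * h + r + 1 \<and> 2 * (h + int t) + r + 1 \<le> int M \<longrightarrow>
        finite_folding (window (\<lambda>k. a (2 * k + r + 1)) h t))"

lemma unfolds_within_mono:
  assumes "unfolds_within a r M" "N \<le> M"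
  shows "unfolds_within a r N"
proof -
  have "- int N \<le> x \<and> y \<le> int N \<Longrightarrow> - int M \<le> x \<and> y \<le> int M" for x y
    using assms(2) by linarith
  then show ?thesis using assms(1) unfolding unfolds_within_def by blast
qed

lemma sublist_window:
  assumes "\<And>i. i < t \<Longrightarrow> j + i < length T \<and> T ! (j + i) = a (h + int i)"
  shows "sublist (window a h t) T"
proof (cases "t = 0")
  case True
  then show ?thesis by (simp add: window_def)
next
  case False
  with assms[of "t - 1"] have "j + t \<le> length T" by auto
  then have "window a h t = take t (drop j T)"
    using assms by (auto simp: list_eq_iff_nth_eq)
  then show ?thesis
    by (metis sublist_drop sublist_order.order_trans sublist_take)
qed

text \<open>The central block of \<open>a\<close> lies in some folding list, which is an
  interleaving. The parity of the offset of the block in that list yields \<open>r\<close>.\<close>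

lemma unfolds_within_ex:
  assumes "complete_folding a"
  shows "\<exists>r\<in>{0, 1}. unfolds_within a r M"
proof -
  define u where "u = window a (- int M) (2 * M + 1)"
  have "finite_folding u"
    using assms unfolding complete_folding_def subword_window_iff u_def by (metis length_window)
  then obtain n T where T: "n_folding n T" "sublist u T" by (auto simp: finite_folding_def)
  from T(2) obtain ps ss where ps: "T = ps @ u @ ss" by (auto simp: sublist_def)
  have "n \<noteq> 0" using T(1) ps by (auto elim: n_folding.cases simp: u_def window_def)
  then obtain m where "n = Suc m" by (cases n) auto
  with T(1) n_folding_Suc_interleave obtain e T' where
    T': "n_folding m T'" "T = interleave e T'" by blast
  \<comment> \<open>Position \<open>k\<close> of \<open>a\<close> corresponds to index
    \<open>k + s\<close> of \<open>T\<close>.\<close>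
  define s where "s = int (length ps) + int M"
  have lenT: "length ps + (2 * M + 1) \<le> 2 * length T' + 1"
    using arg_cong[OF ps, of length] T'(2) by (simp add: u_def)
  have val: "T ! nat (k + s) = a k" if "- int M \<le> k" "k \<le> int M" for k
  proof -
    have "nat (k + s) = length ps + nat (k + int M)" "nat (k + int M) < length u"
      using that by (auto simp: s_def u_def)
    then have "T ! nat (k + s) = u ! nat (k + int M)"
      by (simp add: ps nth_append)
    also have "\<dots> = a k"
      using that unfolding u_def by (subst nth_window) auto
    finally show ?thesis .
  qed
  have ev: "a (2 * k - s) = alternate e k"
    if "- int M \<le> 2 * k - s" "2 * k - s \<le> int M" for k
  proof -
    have k: "0 \<le> k" "nat k \<le> length T'" using that lenT by (auto simp: s_def)
    have "a (2 * k - s) = T ! (2 * nat k)"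
      using val[OF that] k by (simp add: nat_mult_distrib)
    then show ?thesis using nth_interleave_even[OF k(2), of e] k T'(2) by simp
  qed
  have od: "k \<ge> 0 \<and> nat k < length T' \<and> a (2 * k + 1 - s) = T' ! nat k"
    if "- int M \<le> 2 * k + 1 - s" "2 * k + 1 - s \<le> int M" for k
  proof -
    have k: "0 \<le> k" "nat k < length T'" using that lenT by (auto simp: s_def)
    have "nat (2 * k + 1) = Suc (2 * nat k)" using k by simp
    then have "a (2 * k + 1 - s) = T ! Suc (2 * nat k)"
      using val[OF that] by simp
    then show ?thesis using nth_interleave_odd[OF k(2), of e] k T'(2) by simp
  qed
  define r where "r = s mod 2"
  define q where "q = s div 2"
  have s: "s = 2 * q + r" by (simp add: r_def q_def)
  have r: "r \<in> {0, 1}" by (auto simp: r_def)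
  \<comment> \<open>Shifting half-indices by \<open>d\<close> turns \<open>2 * k - s\<close> into
    \<open>2 * k + r\<close>, which passes from indices of \<open>T\<close> to the form used in
    \<open>unfolds_within\<close>.\<close>
  define d where "d = q + r"
  have sd: "2 * d - s = r" by (simp add: d_def s)
  have "unfolds_within a r M"
    unfolding unfolds_within_def
  proof (intro conjI allI impI)
    fix k assume k: "- int M \<le> 2 * k + r \<and> 2 * k + r + 2 \<le> int M"
    have idx: "2 * (k + d) - s = 2 * k + r" "2 * (k + d + 1) - s = 2 * k + r + 2"
      using sd by auto
    show "a (2 * k + r + 2) = - a (2 * k + r)"
      using ev[of "k + d", unfolded idx] ev[of "k + d + 1", unfolded idx] k
      by (simp add: alternate_def)
  next
    fix h t assume ht: "- int M \<le> 2 * h + r + 1 \<and> 2 * (h + int t) + r + 1 \<le> int M"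
    have idx: "2 * (h + int i + d) + 1 - s = 2 * (h + int i) + r + 1" for i
      using sd by auto
    have *: "h + int i + d \<ge> 0 \<and> nat (h + int i + d) < length T' \<and>
        a (2 * (h + int i) + r + 1) = T' ! nat (h + int i + d)" if "i < t" for i
      using od[of "h + int i + d"] ht that unfolding idx by auto
    have "sublist (window (\<lambda>k. a (2 * k + r + 1)) h t) T'"
    proof (rule sublist_window[where j = "nat (h + d)"])
      fix i assume i: "i < t"
      have "nat (h + d) + i = nat (h + int i + d)"
        using *[of 0] i by auto
      then show "nat (h + d) + i < length T' \<and> T' ! (nat (h + d) + i) = a (2 * (h + int i) + r + 1)"
        using *[OF i] by auto
    qed
    with T'(1) show "finite_folding (window (\<lambda>k. a (2 * k + r + 1)) h t)"
      by (auto simp: finite_folding_def)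
  qed
  with r show ?thesis by blast
qed

lemma alternate_of_step:
  assumes "\<And>k. f (k + 1) = - f k"
  shows "f k = alternate (f 0) k"
proof (induction k rule: int_induct[where k = 0])
  case (step2 i)
  then show ?case using assms[of "i - 1"] by (auto simp: alternate_def split: if_splits)
qed (auto simp: assms alternate_def)

text \<open>A compactness argument: the parity \<open>r\<close> found for radius \<open>M\<close>
  may depend on \<open>M\<close>, but it has only two possible values and the property passes to
  smaller radii, so one \<open>r\<close> serves all \<open>M\<close>.\<close>

lemma complete_folding_unfold:
  assumes "complete_folding a"
  obtains c e b where "e \<in> {1, - 1}" "complete_folding b"
    "\<And>k. a (c + 2 * k) = b k" "\<And>k. a (c + 2 * k + 1) = alternate e k"
proof -
  have "\<exists>r. \<forall>M. unfolds_within a r M"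
  proof (rule ccontr)
    assume "\<not> ?thesis"
    then obtain M0 M1 where "\<not> unfolds_within a 0 M0" "\<not> unfolds_within a 1 M1" by metis
    then show False
      using unfolds_within_ex[OF assms, of "max M0 M1"]
        unfolds_within_mono[of a _ "max M0 M1"] by auto
  qed
  then obtain r where r: "\<And>M. unfolds_within a r M" by blast
  have val: "a k \<in> {1, - 1}" for k using assms by (auto simp: complete_folding_def)
  have step: "a (2 * (k + 1) + r) = - a (2 * k + r)" for k
    using r[of "nat (\<bar>2 * k + r\<bar> + 2)"] unfolding unfolds_within_def
    by (auto simp: algebra_simps dest!: spec[of _ k])
  define b where "b k = a (2 * k + r + 1)" for k
  have "finite_folding (window b h t)" for h t
  proof -
    have "- int (nat (\<bar>2 * h + r + 1\<bar> + 2 * int t)) \<le> 2 * h + r + 1 \<and>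
      2 * (h + int t) + r + 1 \<le> int (nat (\<bar>2 * h + r + 1\<bar> + 2 * int t))" by auto
    then show ?thesis
      using r[of "nat (\<bar>2 * h + r + 1\<bar> + 2 * int t)"]
      unfolding unfolds_within_def b_def by blast
  qed
  then have "complete_folding b"
    using val unfolding complete_folding_def subword_window_iff b_def by metis
  moreover have "a (r + 1 + 2 * k) = b k" for k by (simp add: b_def algebra_simps)
  \<comment> \<open>With \<open>c = r + 1\<close>, the alternating term following \<open>b 0\<close>
    is \<open>a (2 + r)\<close>, which fixes the phase \<open>e\<close>.\<close>
  moreover have "a (r + 1 + 2 * k + 1) = alternate (a (2 + r)) k" for k
    using alternate_of_step[of "\<lambda>k. a (2 * (k + 1) + r)" k, OF step]
    by (simp add: algebra_simps)
  ultimately show ?thesis using that val by metis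
qed

section \<open>Counting windows together with the parity of their position\<close>

definition parity_windows :: "(int \<Rightarrow> int) \<Rightarrow> nat \<Rightarrow> (bool \<times> int list) set" where
  "parity_windows a t = range (\<lambda>h. (even h, window a h t))"

text \<open>Rebuilds a window of \<open>a\<close> from a window of \<open>b\<close> tagged with its
  parity: \<open>s\<close> tells whether the first entry is an alternating term, the tag selects the
  phase of the alternating terms, and the list fills the other places.\<close>

definition mesh :: "int \<Rightarrow> bool \<Rightarrow> nat \<Rightarrow> bool \<times> int list \<Rightarrow> int list" where
  "mesh e s t x = map (\<lambda>i. if even i = s then alternate (if fst x then e else - e) (int (i div 2))
     else snd x ! (i div 2)) [0..<t]"

text \<open>The bounds on \<open>t\<close> ensure that at least one alternating entry is visible, at
  index 0 or 1; as \<open>e\<close> is nonzero, its sign reveals the tag. The value of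
  \<open>n\<close> is the number of remaining places, so the whole list can be read off.\<close>

lemma inj_on_mesh:
  assumes e: "e \<noteq> 0"
    and pos: "if s then t \<ge> 1 \<and> n = t div 2 else t \<ge> 2 \<and> n = (t + 1) div 2"
    and X: "\<And>x. x \<in> X \<Longrightarrow> length (snd x) = n"
  shows "inj_on (mesh e s t) X"
proof (rule inj_onI)
  fix x y assume xy: "x \<in> X" "y \<in> X" "mesh e s t x = mesh e s t y"
  have len: "length (snd x) = n" "length (snd y) = n" using X xy by auto
  have nth: "mesh e s t z ! i = (if even i = s then alternate (if fst z then e else - e) (int (i div 2))
     else snd z ! (i div 2))" if "i < t" for z i
    using that by (simp add: mesh_def)
  have eq: "mesh e s t x ! i = mesh e s t y ! i" for i using xy by simp
  have "fst x = fst y"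
  proof (cases s)
    case True
    then show ?thesis using eq[of 0] pos e nth[of 0] by (auto simp: alternate_def split: if_splits)
  next
    case False
    then show ?thesis using eq[of 1] pos e nth[of 1] by (auto simp: alternate_def split: if_splits)
  qed
  moreover have "snd x ! j = snd y ! j" if "j < n" for j
  proof (cases s)
    case True
    then show ?thesis using eq[of "2 * j + 1"] pos that nth[of "2 * j + 1"] by auto
  next
    case False
    then show ?thesis using eq[of "2 * j"] pos that nth[of "2 * j"] by auto
  qed
  then have "snd x = snd y" using len by (auto simp: list_eq_iff_nth_eq)
  ultimately show "x = y" by (simp add: prod_eq_iff)
qed

lemma finite_range_window:
  assumes "complete_folding a"
  shows "finite (range (\<lambda>h. window a h t))"
proof (rule finite_subset)
  show "range (\<lambda>h. window a h t) \<subseteq> {xs. set xs \<subseteq> {1, - 1} \<and> length xs = t}"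
    using assms by (auto simp: window_def complete_folding_def)
  show "finite {xs :: int list. set xs \<subseteq> {1, - 1} \<and> length xs = t}"
    by (rule finite_lists_length_eq) simp
qed

text \<open>The two ranges may overlap as sets of words; the parity tags keep them apart, so their
  cardinalities add.\<close>

lemma card_parity_windows_split:
  assumes "complete_folding a"
  shows "card (parity_windows a t) =
    card (range (\<lambda>k. window a (c + 2 * k) t)) + card (range (\<lambda>k. window a (c + 2 * k + 1) t))"
    (is "_ = card ?A + card ?B")
proof -
  have fin: "finite ?A" "finite ?B"
    by (auto intro: finite_subset[OF _ finite_range_window[OF assms, of t]])
  have "parity_windows a t = Pair (even c) ` ?A \<union> Pair (odd c) ` ?B"
  proof (intro equalityI subsetI)
    fix x assume "x \<in> parity_windows a t"
    then obtain h where h: "x = (even h, window a h t)" by (auto simp: parity_windows_def)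
    define k where "k = (h - c) div 2"
    have "h = c + 2 * k \<or> h = c + 2 * k + 1" unfolding k_def by presburger
    then show "x \<in> Pair (even c) ` ?A \<union> Pair (odd c) ` ?B" using h by auto
  next
    fix x assume "x \<in> Pair (even c) ` ?A \<union> Pair (odd c) ` ?B"
    then obtain k where "x = (even c, window a (c + 2 * k) t) \<or> x = (odd c, window a (c + 2 * k + 1) t)"
      by auto
    moreover have "even c = even (c + 2 * k)" "odd c = even (c + 2 * k + 1)" by auto
    ultimately show "x \<in> parity_windows a t" unfolding parity_windows_def by blast
  qed
  moreover have "Pair (even c) ` ?A \<inter> Pair (odd c) ` ?B = {}" by auto
  ultimately show ?thesis
    using fin by (simp add: card_Un_disjoint card_image inj_on_def)
qed

text \<open>A window starting at an alternating term first meets \<open>b (k + 1)\<close>. The tag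
  is therefore the parity of \<open>k + 1\<close>, and this change of parity is compensated by
  \<open>- e\<close>.\<close>

lemma window_unfold:
  assumes "\<And>k. a (c + 2 * k) = b k" "\<And>k. a (c + 2 * k + 1) = alternate e k"
  shows "window a (c + 2 * k) t = mesh e False t (even k, window b k ((t + 1) div 2))"
    and "window a (c + 2 * k + 1) t = mesh (- e) True t (even (k + 1), window b (k + 1) (t div 2))"
proof -
  have ev: "a (c + 2 * k + 2 * int j) = b (k + int j)" for k j
    using assms(1)[of "k + int j"] by (simp add: algebra_simps)
  have od: "a (c + 2 * k + 2 * int j + 1) = alternate e (k + int j)" for k j
    using assms(2)[of "k + int j"] by (simp add: algebra_simps)
  show "window a (c + 2 * k) t = mesh e False t (even k, window b k ((t + 1) div 2))"
  proof (rule nth_equalityI)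
    fix i assume "i < length (window a (c + 2 * k) t)"
    then show "window a (c + 2 * k) t ! i
        = mesh e False t (even k, window b k ((t + 1) div 2)) ! i"
      using ev[of k "i div 2"] od[of k "i div 2"]
      by (cases "even i") (auto simp: mesh_def alternate_def algebra_simps elim!: evenE oddE)
  qed (simp add: mesh_def)
  show "window a (c + 2 * k + 1) t = mesh (- e) True t (even (k + 1), window b (k + 1) (t div 2))"
  proof (rule nth_equalityI)
    fix i assume "i < length (window a (c + 2 * k + 1) t)"
    then show "window a (c + 2 * k + 1) t ! i
        = mesh (- e) True t (even (k + 1), window b (k + 1) (t div 2)) ! i"
      using ev[of "k + 1" "i div 2"] od[of k "i div 2"]
      by (cases "even i") (auto simp: mesh_def alternate_def algebra_simps elim!: evenE oddE)
  qed (simp add: mesh_def)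
qed

lemma range_shift: "range (\<lambda>k :: int. f (k + 1)) = range f"
  using image_image[of f "\<lambda>k :: int. k + 1" UNIV] by (simp add: surj_plus_right)

lemma
  assumes e: "e \<noteq> 0"
    and ab: "\<And>k. a (c + 2 * k) = b k" "\<And>k. a (c + 2 * k + 1) = alternate e k"
  shows card_unfold_even: "t \<ge> 2 \<Longrightarrow>
      card (range (\<lambda>k. window a (c + 2 * k) t)) = card (parity_windows b ((t + 1) div 2))"
    and card_unfold_odd: "t \<ge> 1 \<Longrightarrow>
      card (range (\<lambda>k. window a (c + 2 * k + 1) t)) = card (parity_windows b (t div 2))"
proof -
  note unfold = window_unfold[of a c b e, OF ab]
  have "range (\<lambda>k. window a (c + 2 * k) t) = mesh e False t ` parity_windows b ((t + 1) div 2)"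
    unfolding unfold parity_windows_def by (simp add: image_image)
  moreover have "inj_on (mesh e False t) (parity_windows b ((t + 1) div 2))" if "t \<ge> 2"
    using that e by (intro inj_on_mesh) (auto simp: parity_windows_def)
  ultimately show "t \<ge> 2 \<Longrightarrow>
      card (range (\<lambda>k. window a (c + 2 * k) t)) = card (parity_windows b ((t + 1) div 2))"
    by (simp add: card_image)
  have "range (\<lambda>k. window a (c + 2 * k + 1) t) = mesh (- e) True t ` parity_windows b (t div 2)"
    unfolding unfold parity_windows_def image_image
    by (rule range_shift[of "\<lambda>k. mesh (- e) True t (even k, window b k (t div 2))"])
  moreover have "inj_on (mesh (- e) True t) (parity_windows b (t div 2))" if "t \<ge> 1"
    using that e by (intro inj_on_mesh) (auto simp: parity_windows_def)
  ultimately show "t \<ge> 1 \<Longrightarrow>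
      card (range (\<lambda>k. window a (c + 2 * k + 1) t)) = card (parity_windows b (t div 2))"
    by (simp add: card_image)
qed

text \<open>The alternating half of \<open>a\<close> takes both values on one parity class. On the
  other class lies \<open>b\<close>, whose own alternating half takes both values.\<close>

lemma complete_folding_attains:
  assumes "complete_folding a" "x \<in> {1, - 1}"
  shows "\<exists>k. even k = p \<and> a k = x"
proof -
  have alt: "\<exists>k. alternate e k = x" if "e \<in> {1, - 1}" for e
  proof
    show "alternate e (if e = x then 0 else 1) = x"
      using that assms(2) by (auto simp: alternate_def)
  qed
  obtain c e b where a: "e \<in> {1, - 1}" "complete_folding b"
    "\<And>k. a (c + 2 * k) = b k" "\<And>k. a (c + 2 * k + 1) = alternate e k"
    by (rule complete_folding_unfold[OF assms(1)]) (rule that)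
  obtain c' e' b' where b: "e' \<in> {1, - 1}" "complete_folding b'"
    "\<And>k. b (c' + 2 * k) = b' k" "\<And>k. b (c' + 2 * k + 1) = alternate e' k"
    by (rule complete_folding_unfold[OF a(2)]) (rule that)
  obtain i j where "alternate e i = x" "alternate e' j = x" using alt a(1) b(1) by blast
  then have "a (c + 2 * i + 1) = x" "a (c + 2 * (c' + 2 * j + 1)) = x"
    using a(4)[of i] a(3)[of "c' + 2 * j + 1"] b(4)[of j] by simp_all
  moreover have "even (c + 2 * i + 1) \<noteq> even (c + 2 * (c' + 2 * j + 1))" by simp
  ultimately show ?thesis by (metis (full_types))
qed

lemma card_parity_windows:
  assumes "complete_folding a" "t \<ge> 1"
  shows "card (parity_windows a t) = 4 * t"
  using assms
proof (induction t arbitrary: a rule: less_induct)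
  case (less t)
  obtain c e b where a: "e \<in> {1, - 1}" "complete_folding b"
    "\<And>k. a (c + 2 * k) = b k" "\<And>k. a (c + 2 * k + 1) = alternate e k"
    by (rule complete_folding_unfold[OF less.prems(1)]) (rule that)
  have e: "e \<noteq> 0" using a(1) by auto
  note split = card_parity_windows_split[OF less.prems(1), of t c]
  show ?case
  proof (cases "t = 1")
    case True
    \<comment> \<open>Here the halves of \<open>t\<close> are 0 and 1, so the recursion does not
      descend. Starts at alternating terms contribute the empty window with its two tags; the other
      starts contribute the two values of \<open>b\<close>.\<close>
    have "(even (0 :: int), window b 0 0) \<in> parity_windows b 0"
      "(even (1 :: int), window b 1 0) \<in> parity_windows b 0"
      unfolding parity_windows_def by blast+
    moreover have "parity_windows b 0 \<subseteq> {(True, []), (False, [])}"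
      by (auto simp: parity_windows_def window_def)
    ultimately have "parity_windows b 0 = {(True, []), (False, [])}"
      by (auto simp: window_def)
    then have "card (range (\<lambda>k. window a (c + 2 * k + 1) t)) = 2"
      using card_unfold_odd[OF e a(3,4), of t] True by simp
    moreover have "range (\<lambda>k. window a (c + 2 * k) t) = {[1], [- 1]}"
    proof -
      have "window a (c + 2 * k) t = [b k]" for k using True a(3) by (simp add: window_def)
      moreover have "range b = {1, - 1}"
        using complete_folding_attains[OF a(2)] a(2)
        by (auto simp: complete_folding_def) (metis rangeI)+
      ultimately show ?thesis by (simp add: image_image[of "\<lambda>x. [x]" b UNIV, symmetric])
    qed
    ultimately show ?thesis using split True by simp
  next
    case False
    then have t: "t \<ge> 2" using less.prems by auto
    have "card (parity_windows b ((t + 1) div 2)) = 4 * ((t + 1) div 2)"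
      using t by (intro less.IH a(2)) auto
    moreover have "card (parity_windows b (t div 2)) = 4 * (t div 2)"
      using t by (intro less.IH a(2)) auto
    moreover have "(t + 1) div 2 + t div 2 = t" by presburger
    ultimately show ?thesis
      using split card_unfold_even[OF e a(3,4) t] card_unfold_odd[OF e a(3,4), of t] t by simp
  qed
qed

section \<open>Lengths at least 7\<close>

text \<open>One of the pairs \<open>k\<close>, \<open>k + 2\<close> and \<open>k + 1\<close>,
  \<open>k + 3\<close> consists of neighbouring terms of the alternating half of \<open>b\<close>,
  which have opposite signs.\<close>

lemma no_alternating_four:
  assumes "complete_folding b"
  shows "\<not> (b (k + 2) = b k \<and> b (k + 3) = b (k + 1))"
proof -
  obtain c e b' where b: "e \<in> {1, - 1}" "complete_folding b'"
    "\<And>k. b (c + 2 * k) = b' k" "\<And>k. b (c + 2 * k + 1) = alternate e k"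
    by (rule complete_folding_unfold[OF assms]) (rule that)
  define j where "j = (k - c) div 2"
  have "k = c + 2 * j \<or> k = c + 2 * j + 1" unfolding j_def by presburger
  then show ?thesis
    using b(1) b(4)[of j] b(4)[of "j + 1"] by (auto simp: alternate_def algebra_simps split: if_splits)
qed

lemma card_subwords_ge_7:
  assumes "complete_folding a" "t \<ge> 7"
  shows "card (subwords_of_length t a) = 4 * t"
proof -
  obtain c e b where a: "e \<in> {1, - 1}" "complete_folding b"
    "\<And>k. a (c + 2 * k) = b k" "\<And>k. a (c + 2 * k + 1) = alternate e k"
    by (rule complete_folding_unfold[OF assms(1)]) (rule that)
  let ?A = "range (\<lambda>k. window a (c + 2 * k) t)" and ?B = "range (\<lambda>k. window a (c + 2 * k + 1) t)"
  have fin: "finite ?A" "finite ?B"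
    by (auto intro: finite_subset[OF _ finite_range_window[OF assms(1), of t]])
  have "?A \<inter> ?B = {}"
  proof (rule ccontr)
    assume "?A \<inter> ?B \<noteq> {}"
    then obtain k l where "window a (c + 2 * k) t = window a (c + 2 * l + 1) t" by auto
    then have "a (c + 2 * k + int i) = a (c + 2 * l + 1 + int i)" if "i < 7" for i
      using that assms(2) by (auto simp: window_eq_iff)
    \<comment> \<open>Entries 0, 2, 4, 6 are four consecutive terms of \<open>b\<close> in one
      window and four alternating terms in the other. Seeing all four takes length 7.\<close>
    note eq = this[of 0] this[of 2] this[of 4] this[of 6]
    have "b k = alternate e l" "b (k + 1) = alternate e (l + 1)"
      "b (k + 2) = alternate e (l + 2)" "b (k + 3) = alternate e (l + 3)"
      using eq a(3)[of k] a(3)[of "k + 1"] a(3)[of "k + 2"] a(3)[of "k + 3"]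
        a(4)[of l] a(4)[of "l + 1"] a(4)[of "l + 2"] a(4)[of "l + 3"]
      by (simp_all add: algebra_simps)
    then show False using no_alternating_four[OF a(2), of k] by (auto simp: alternate_def)
  qed
  moreover have "subwords_of_length t a = ?A \<union> ?B"
  proof -
    have "window a h t \<in> ?A \<union> ?B" for h
    proof -
      define k where "k = (h - c) div 2"
      have "h = c + 2 * k \<or> h = c + 2 * k + 1" unfolding k_def by presburger
      then show ?thesis by auto
    qed
    then show ?thesis by (auto simp: subwords_of_length_eq_range)
  qed
  ultimately show ?thesis
    using fin card_parity_windows_split[OF assms(1), of t c] card_parity_windows[OF assms(1), of t] assms(2)
    by (simp add: card_Un_disjoint)
qed

section \<open>Lengths at most 6\<close>

text \<open>Three unfoldings determine a sequence, up to a shift, outside the multiples of 8;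
  \<open>x\<close> stands for the value at such a multiple.\<close>

definition skeleton :: "int \<Rightarrow> int \<Rightarrow> int \<Rightarrow> int \<Rightarrow> int \<Rightarrow> int" where
  "skeleton e0 e1 e2 x m =
     (if m mod 2 = 1 then (if m mod 4 = 1 then e0 else - e0)
      else if m mod 4 = 2 then (if m mod 8 = 2 then e1 else - e1)
      else if m mod 8 = 4 then (if m mod 16 = 4 then e2 else - e2)
      else x)"

text \<open>For fixed \<open>x\<close> the skeleton has period 16, so 16 starting points suffice. A
  single \<open>x\<close> per word is enough for lengths up to 8, since such a window meets at most
  one multiple of 8.\<close>

definition skeleton_words :: "int \<Rightarrow> int \<Rightarrow> int \<Rightarrow> nat \<Rightarrow> int list list" where
  "skeleton_words e0 e1 e2 t =
     concat (map (\<lambda>h. map (\<lambda>x. map (\<lambda>i. skeleton e0 e1 e2 x (int h + int i)) [0..<t]) [1, - 1]) [0..<16])"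

lemma complete_folding_skeleton:
  assumes "complete_folding a"
  obtains c e0 e1 e2 b where "e0 \<in> {1, - 1}" "e1 \<in> {1, - 1}" "e2 \<in> {1, - 1}" "complete_folding b"
    "\<And>m. a (c + m) = skeleton e0 e1 e2 (b (m div 8)) m"
proof -
  obtain c e b where a: "e \<in> {1, - 1}" "complete_folding b"
    "\<And>k. a (c + 2 * k) = b k" "\<And>k. a (c + 2 * k + 1) = alternate e k"
    by (rule complete_folding_unfold[OF assms(1)]) (rule that)
  obtain c' e' b' where b: "e' \<in> {1, - 1}" "complete_folding b'"
    "\<And>k. b (c' + 2 * k) = b' k" "\<And>k. b (c' + 2 * k + 1) = alternate e' k"
    by (rule complete_folding_unfold[OF a(2)]) (rule that)
  obtain c'' e'' b'' where b': "e'' \<in> {1, - 1}" "complete_folding b''"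
    "\<And>k. b' (c'' + 2 * k) = b'' k" "\<And>k. b' (c'' + 2 * k + 1) = alternate e'' k"
    by (rule complete_folding_unfold[OF b(2)]) (rule that)
  \<comment> \<open>The position of \<open>b'' 0\<close> in \<open>a\<close>. Moving the origin
    there changes the phases of the first two alternating sequences to \<open>e0\<close> and
    \<open>e1\<close>.\<close>
  define d where "d = c + 2 * c' + 4 * c''"
  define e0 where "e0 = alternate e c'"
  define e1 where "e1 = alternate e' c''"
  have "a (d + (2 * k + 1)) = alternate e0 k" for k
    using a(4)[of "c' + 2 * c'' + k"] by (simp add: d_def e0_def alternate_def algebra_simps)
  moreover have "a (d + (4 * k + 2)) = alternate e1 k" for k
    using a(3)[of "c' + 2 * c'' + 2 * k + 1"] b(4)[of "c'' + k"]
    by (simp add: d_def e1_def alternate_def algebra_simps)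
  moreover have "a (d + (8 * k + 4)) = alternate e'' k" for k
    using a(3)[of "c' + 2 * c'' + 4 * k + 2"] b(3)[of "c'' + 2 * k + 1"] b'(4)[of k]
    by (simp add: d_def algebra_simps)
  moreover have "a (d + 8 * k) = b'' k" for k
    using a(3)[of "c' + 2 * c'' + 4 * k"] b(3)[of "c'' + 2 * k"] b'(3)[of k]
    by (simp add: d_def algebra_simps)
  ultimately have val: "a (d + (2 * k + 1)) = alternate e0 k" "a (d + (4 * k + 2)) = alternate e1 k"
    "a (d + (8 * k + 4)) = alternate e'' k" "a (d + 8 * k) = b'' k" for k by blast+
  have "a (d + m) = skeleton e0 e1 e'' (b'' (m div 8)) m" for m
  proof -
    have "m mod 2 = 1 \<or> m mod 4 = 2 \<or> m mod 8 = 4 \<or> m mod 8 = 0" by presburger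
    then consider "m mod 2 = 1" | "m mod 4 = 2" | "m mod 8 = 4" | "m mod 8 = 0" by blast
    then show ?thesis
    proof cases
      case 1
      then have m: "m = 2 * (m div 2) + 1" by presburger
      have "even (m div 2) \<longleftrightarrow> m mod 4 = 1" using 1 by presburger
      then show ?thesis using val(1)[of "m div 2"] 1 m[symmetric] by (simp add: skeleton_def alternate_def)
    next
      case 2
      then have m: "m = 4 * (m div 4) + 2" by presburger
      have "even (m div 4) \<longleftrightarrow> m mod 8 = 2" "m mod 2 \<noteq> 1" using 2 by presburger+
      then show ?thesis using val(2)[of "m div 4"] 2 m[symmetric] by (simp add: skeleton_def alternate_def)
    next
      case 3
      then have m: "m = 8 * (m div 8) + 4" by presburger
      have "even (m div 8) \<longleftrightarrow> m mod 16 = 4" "m mod 2 \<noteq> 1" "m mod 4 \<noteq> 2" using 3 by presburger+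
      then show ?thesis using val(3)[of "m div 8"] 3 m[symmetric] by (simp add: skeleton_def alternate_def)
    next
      case 4
      then have m: "m = 8 * (m div 8)" by presburger
      have "m mod 2 \<noteq> 1" "m mod 4 \<noteq> 2" using 4 by presburger+
      then show ?thesis using val(4)[of "m div 8"] 4 m[symmetric] by (simp add: skeleton_def)
    qed
  qed
  moreover have "e0 \<in> {1, - 1}" "e1 \<in> {1, - 1}"
    using a(1) b(1) by (auto simp: e0_def e1_def alternate_def)
  ultimately show ?thesis using that b' by blast
qed

lemma skeleton_cong:
  assumes "m mod 16 = n mod 16" "m mod 8 = 0 \<Longrightarrow> x = y"
  shows "skeleton e0 e1 e2 x m = skeleton e0 e1 e2 y n"
proof -
  have "m mod d = n mod d" if "d dvd 16" for d
    using mod_mod_cancel[OF that, of m] mod_mod_cancel[OF that, of n] assms(1) by simp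
  from this[of 2] this[of 4] this[of 8]
  have "m mod 2 = n mod 2" "m mod 4 = n mod 4" "m mod 8 = n mod 8" by simp_all
  note mods = this assms(1)
  show ?thesis
  proof (cases "m mod 8 = 0")
    case True
    then show ?thesis using assms(2) by (simp only: skeleton_def mods)
  next
    case False
    then have "n mod 2 = 1 \<or> n mod 4 = 2 \<or> n mod 8 = 4" unfolding mods by presburger
    then show ?thesis unfolding skeleton_def mods by argo
  qed
qed

text \<open>Exactly one of \<open>n\<close>, ..., \<open>n + 7\<close> is a multiple of 8, and its
  quotient is expressed without reference to \<open>j\<close>. This gives one value \<open>x\<close>
  for a whole window.\<close>

lemma div_8_of_mod_8:
  fixes n j :: int
  assumes "0 \<le> j" "j < 8" "(n + j) mod 8 = 0"
  shows "(n + j) div 8 = (n + 7) div 8"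
proof -
  from assms(3) obtain q where "n + j = 8 * q" by (auto elim: dvdE)
  then have "n + 7 = 8 * q + (7 - j)" by simp
  with \<open>n + j = 8 * q\<close> assms(1,2) show ?thesis by simp
qed

text \<open>One inclusion reduces the starting point modulo 16. The other must realise every pair of
  a starting point and a value \<open>x\<close>, which \<open>complete_folding_attains\<close> makes
  possible.\<close>

lemma subwords_skeleton:
  assumes b: "complete_folding b" and a: "\<And>m. a (c + m) = skeleton e0 e1 e2 (b (m div 8)) m"
    and t: "t \<le> 8"
  shows "subwords_of_length t a = set (skeleton_words e0 e1 e2 t)"
proof (intro equalityI subsetI)
  fix u assume "u \<in> subwords_of_length t a"
  then obtain g where g: "u = window a g t" by (auto simp: subwords_of_length_eq_range)
  define n where "n = g - c"
  define h where "h = nat (n mod 16)"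
  define x where "x = b ((n + 7) div 8)"
  have h: "h < 16" "int h = n mod 16" by (auto simp: h_def)
  have x: "x \<in> {1, - 1}" using b by (auto simp: x_def complete_folding_def)
  have "a (g + int i) = skeleton e0 e1 e2 x (int h + int i)" if "i < t" for i
  proof -
    have "a (g + int i) = skeleton e0 e1 e2 (b ((n + int i) div 8)) (n + int i)"
      using a[of "n + int i"] by (simp add: n_def)
    also have "\<dots> = skeleton e0 e1 e2 x (int h + int i)"
    proof (rule skeleton_cong)
      show "(n + int i) mod 16 = (int h + int i) mod 16" unfolding h by presburger
      assume "(n + int i) mod 8 = 0"
      moreover have "int i < 8" using that t by simp
      ultimately have "(n + int i) div 8 = (n + 7) div 8" by (simp only: div_8_of_mod_8 of_nat_0_le_iff)
      then show "b ((n + int i) div 8) = x" by (simp add: x_def)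
    qed
    finally show ?thesis .
  qed
  then have "u = map (\<lambda>i. skeleton e0 e1 e2 x (int h + int i)) [0..<t]" by (simp add: g window_def)
  then show "u \<in> set (skeleton_words e0 e1 e2 t)"
    unfolding skeleton_words_def using h(1) x by auto
next
  fix u assume "u \<in> set (skeleton_words e0 e1 e2 t)"
  then have "\<exists>h\<in>{0..<16}. \<exists>x\<in>{1, - 1}. u = map (\<lambda>i. skeleton e0 e1 e2 x (int h + int i)) [0..<t]"
    unfolding skeleton_words_def by simp
  then obtain h x where h: "h < 16" "x \<in> {1, - 1}"
    "u = map (\<lambda>i. skeleton e0 e1 e2 x (int h + int i)) [0..<t]"
    by (meson atLeastLessThan_iff)
  define k0 where "k0 = (int h + 7) div 8"
  \<comment> \<open>Equal parity of \<open>k\<close> and \<open>k0\<close> makes the shift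
    \<open>8 * (k - k0)\<close> a multiple of 16. It preserves the skeleton and moves position
    \<open>8 * k0\<close> to \<open>8 * k\<close>, where the value is \<open>x\<close>.\<close>
  obtain k where k: "even k = even k0" "b k = x"
    using complete_folding_attains[OF b h(2)] by blast
  define n where "n = int h + 8 * (k - k0)"
  have "a (c + n + int i) = skeleton e0 e1 e2 x (int h + int i)" if "i < t" for i
  proof -
    have "a (c + n + int i) = skeleton e0 e1 e2 (b ((n + int i) div 8)) (n + int i)"
      using a[of "n + int i"] by (simp add: add.assoc)
    also have "\<dots> = skeleton e0 e1 e2 x (int h + int i)"
    proof (rule skeleton_cong)
      from k(1) have "even (k - k0)" by simp
      then obtain l where "k - k0 = 2 * l" by (rule evenE)
      then have "n + int i = int h + int i + l * 16" by (simp add: n_def)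
      then show "(n + int i) mod 16 = (int h + int i) mod 16" by (metis mod_mult_self1)
      have shift: "n + int i = int h + int i + (k - k0) * 8" by (simp add: n_def)
      assume "(n + int i) mod 8 = 0"
      then have "(int h + int i) mod 8 = 0" unfolding shift by (metis mod_mult_self1)
      moreover have "int i < 8" using that t by simp
      ultimately have "(int h + int i) div 8 = k0"
        unfolding k0_def by (simp only: div_8_of_mod_8 of_nat_0_le_iff)
      then have "(n + int i) div 8 = k" unfolding shift by simp
      then show "b ((n + int i) div 8) = x" by (simp add: k)
    qed
    finally show ?thesis .
  qed
  then have "u = window a (c + n) t" by (simp add: h window_def)
  then show "u \<in> subwords_of_length t a" by (auto simp: subwords_of_length_eq_range)
qed

text \<open>A finite check: only the eight choices of phases remain, because \<open>x\<close> ranges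
  over both signs whatever the sequence \<open>b\<close> is.\<close>

lemma card_skeleton_words:
  assumes "e0 \<in> {1, - 1}" "e1 \<in> {1, - 1}" "e2 \<in> {1, - 1}"
  shows "map (\<lambda>t. card (set (skeleton_words e0 e1 e2 t))) [1, 2, 3, 4, 5, 6] = [2, 4, 8, 12, 18, 23]"
proof -
  \<comment> \<open>Quantifying over explicit lists gives a closed statement that can be
    evaluated.\<close>
  have *: "\<forall>e0\<in>set [1, - 1]. \<forall>e1\<in>set [1, - 1]. \<forall>e2\<in>set [1, - 1].
    map (\<lambda>t. card (set (skeleton_words e0 e1 e2 t))) [1, 2, 3, 4, 5, 6] = [2, 4, 8, 12, 18, 23]"
    by code_simp
  show ?thesis by (rule *[rule_format]) (use assms in auto)
qed

theorem theorem1p8: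
  fixes S :: "int \<Rightarrow> int"
  assumes "complete_folding S"
  shows "(\<forall>t\<ge>7. card (subwords_of_length t S) = 4 * t) \<and>
    card (subwords_of_length 1 S) = 2 \<and>
    card (subwords_of_length 2 S) = 4 \<and>
    card (subwords_of_length 3 S) = 8 \<and>
    card (subwords_of_length 4 S) = 12 \<and>
    card (subwords_of_length 5 S) = 18 \<and>
    card (subwords_of_length 6 S) = 23"
proof -
  obtain c e0 e1 e2 b where e: "e0 \<in> {1, - 1}" "e1 \<in> {1, - 1}" "e2 \<in> {1, - 1}"
    and b: "complete_folding b" "\<And>m. S (c + m) = skeleton e0 e1 e2 (b (m div 8)) m"
    by (rule complete_folding_skeleton[OF assms]) (rule that)
  show ?thesis
    using card_subwords_ge_7[OF assms] card_skeleton_words[OF e] by (simp add: subwords_skeleton[OF b])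
qed

end
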